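(* For every $\gamma>1$, there exists a classical channel $\mathcal{N}\equiv W_{Y|X}$ such that $$\eta^\Delta_{E_\gamma}(\mathcal{N})>\eta^c_{E_\gamma}(\mathcal{N}).$$
   Context: All systems are finite-dimensional. The hockey-stick divergence is $E_\gamma(\rho\|\sigma)=\operatorname{Tr}(\rho-\gamma\sigma)_+$, where $(\cdot)_+$ is the positive part of a Hermitian matrix. A classical channel $W_{Y|X}$ (a conditional probability distribution on finite alphabets) is regarded as the quantum channel $\rho\mapsto\sum_{x,y}W_{Y|X}(y|x)\langle x|\rho|x\rangle\,|y\rangle\langle y|$ with input system $A=X$. A channel on $A$ acts as the identity on the reference $R$. With suprema over all finite-dimensional quantum reference systems $R$ and over states for which the denominator is strictly positive (value $0$ if there are none), $$\eta^c_{E_\gamma}(\mathcal{N})=\sup_{R,\ \rho_{RA}\neq\sigma_{RA},\ \rho_R=\sigma_R}\frac{E_\gamma(\mathcal{N}(\rho_{RA})\|\mathcal{N}(\sigma_{RA}))}{E_\gamma(\rho_{RA}\|\sigma_{RA})},$$ $$\eta^\Delta_{E_\gamma}(\mathcal{N})=\sup_{R,\ \rho_{RA},\sigma_{RA}}\frac{E_\gamma(\mathcal{N}(\rho_{RA})\|\mathcal{N}(\sigma_{RA}))-E_\gamma(\rho_R\|\sigma_R)}{E_\gamma(\rho_{RA}\|\sigma_{RA})-E_\gamma(\rho_R\|\sigma_R)}.$$ *)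

theory Defs
  imports "Jordan_Normal_Form.Schur_Decomposition" "HOL-Library.Extended_Real"
begin

definition mat_trace :: "complex mat \<Rightarrow> complex" where
  "mat_trace A = (\<Sum>i<dim_row A. A $$ (i, i))"

definition hermitian_mat :: "complex mat \<Rightarrow> bool" where
  "hermitian_mat A \<longleftrightarrow> square_mat A \<and> mat_adjoint A = A"

definition unitary_mat :: "complex mat \<Rightarrow> bool" where
  "unitary_mat U \<longleftrightarrow> square_mat U \<and> mat_adjoint U * U = 1\<^sub>m (dim_row U)"

text \<open>The order on the complex numbers is the one of \<^theory>\<open>HOL-Library.Complex_Order\<close>:
  \<^prop>\<open>0 \<le> z\<close> says that \<^term>\<open>z\<close> is real and nonnegative.\<close>

definition psd_mat :: "complex mat \<Rightarrow> bool" where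
  "psd_mat A \<longleftrightarrow> hermitian_mat A \<and>
     (\<forall>v \<in> carrier_vec (dim_row A). 0 \<le> (A *\<^sub>v v) \<bullet>c v)"

definition density_mat :: "nat \<Rightarrow> complex mat \<Rightarrow> bool" where
  "density_mat n \<rho> \<longleftrightarrow> \<rho> \<in> carrier_mat n n \<and> psd_mat \<rho> \<and> mat_trace \<rho> = 1"

text \<open>Functional calculus: if a Hermitian \<open>A\<close> has the spectral decomposition
  \<open>U diag(d) U*\<close> with \<open>U\<close> unitary and \<open>d\<close> real, its positive part is
  \<open>U diag(max(d,0)) U*\<close>, which does not depend on the choice of \<open>U\<close> and \<open>d\<close>.\<close>

definition is_pos_part :: "complex mat \<Rightarrow> complex mat \<Rightarrow> bool" where
  "is_pos_part A P \<longleftrightarrow>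
     (\<exists>U (d :: nat \<Rightarrow> real).
        unitary_mat U \<and> dim_row U = dim_row A \<and>
        A = U * mat_diag (dim_row A) (\<lambda>i. complex_of_real (d i)) * mat_adjoint U \<and>
        P = U * mat_diag (dim_row A) (\<lambda>i. complex_of_real (max (d i) 0)) * mat_adjoint U)"

definition pos_part :: "complex mat \<Rightarrow> complex mat" where
  "pos_part A = (THE P. is_pos_part A P)"

definition hockey_stick :: "real \<Rightarrow> complex mat \<Rightarrow> complex mat \<Rightarrow> real" where
  "hockey_stick \<gamma> \<rho> \<sigma> = Re (mat_trace (pos_part (\<rho> - complex_of_real \<gamma> \<cdot>\<^sub>m \<sigma>)))"

text \<open>The basis vector \<open>|r>|a>\<close> of the composite system \<open>RA\<close> has index \<open>r * dA + a\<close>;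
  \<open>subblock dA M r s\<close> is the operator \<open>(<r| \<otimes> I) M (|s> \<otimes> I)\<close> on \<open>A\<close>.\<close>

definition subblock :: "nat \<Rightarrow> complex mat \<Rightarrow> nat \<Rightarrow> nat \<Rightarrow> complex mat" where
  "subblock dA M r s = mat dA dA (\<lambda>(a, b). M $$ (r * dA + a, s * dA + b))"

definition reduced_R :: "nat \<Rightarrow> nat \<Rightarrow> complex mat \<Rightarrow> complex mat" where
  "reduced_R dR dA M = mat dR dR (\<lambda>(r, s). mat_trace (subblock dA M r s))"

text \<open>The extension \<open>id_R \<otimes> \<N>\<close> of a linear map \<open>\<N>\<close> from \<open>dA \<times> dA\<close> to \<open>dB \<times> dB\<close> matrices:
  \<open>\<N>\<close> is applied to every block of \<open>M\<close>.\<close>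

definition id_tensor ::
    "nat \<Rightarrow> nat \<Rightarrow> nat \<Rightarrow> (complex mat \<Rightarrow> complex mat) \<Rightarrow> complex mat \<Rightarrow> complex mat" where
  "id_tensor dR dA dB \<N> M = mat (dR * dB) (dR * dB)
     (\<lambda>(i, j). \<N> (subblock dA M (i div dB) (j div dB)) $$ (i mod dB, j mod dB))"

text \<open>\<open>W y x\<close> stands for \<open>W(y|x)\<close>; the alphabets are \<open>{..<nX}\<close> and \<open>{..<nY}\<close>.\<close>

definition cond_distribution :: "nat \<Rightarrow> nat \<Rightarrow> (nat \<Rightarrow> nat \<Rightarrow> real) \<Rightarrow> bool" where
  "cond_distribution nX nY W \<longleftrightarrow>
     (\<forall>x<nX. (\<forall>y<nY. 0 \<le> W y x) \<and> (\<Sum>y<nY. W y x) = 1)"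

definition classical_channel ::
    "nat \<Rightarrow> nat \<Rightarrow> (nat \<Rightarrow> nat \<Rightarrow> real) \<Rightarrow> complex mat \<Rightarrow> complex mat" where
  "classical_channel nX nY W \<rho> =
     mat_diag nY (\<lambda>y. \<Sum>x<nX. complex_of_real (W y x) * \<rho> $$ (x, x))"

definition sup_or_zero :: "real set \<Rightarrow> ereal" where
  "sup_or_zero S = (if S = {} then 0 else (SUP x\<in>S. ereal x))"

definition eta_c :: "real \<Rightarrow> nat \<Rightarrow> nat \<Rightarrow> (complex mat \<Rightarrow> complex mat) \<Rightarrow> ereal" where
  "eta_c \<gamma> dA dB \<N> = sup_or_zero
     {hockey_stick \<gamma> (id_tensor dR dA dB \<N> \<rho>) (id_tensor dR dA dB \<N> \<sigma>) / hockey_stick \<gamma> \<rho> \<sigma>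
      | dR \<rho> \<sigma>. 0 < dR \<and> density_mat (dR * dA) \<rho> \<and> density_mat (dR * dA) \<sigma> \<and>
          \<rho> \<noteq> \<sigma> \<and> reduced_R dR dA \<rho> = reduced_R dR dA \<sigma> \<and>
          0 < hockey_stick \<gamma> \<rho> \<sigma>}"

definition eta_Delta :: "real \<Rightarrow> nat \<Rightarrow> nat \<Rightarrow> (complex mat \<Rightarrow> complex mat) \<Rightarrow> ereal" where
  "eta_Delta \<gamma> dA dB \<N> = sup_or_zero
     {(hockey_stick \<gamma> (id_tensor dR dA dB \<N> \<rho>) (id_tensor dR dA dB \<N> \<sigma>)
         - hockey_stick \<gamma> (reduced_R dR dA \<rho>) (reduced_R dR dA \<sigma>))
      / (hockey_stick \<gamma> \<rho> \<sigma>
         - hockey_stick \<gamma> (reduced_R dR dA \<rho>) (reduced_R dR dA \<sigma>))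
      | dR \<rho> \<sigma>. 0 < dR \<and> density_mat (dR * dA) \<rho> \<and> density_mat (dR * dA) \<sigma> \<and>
          0 < hockey_stick \<gamma> \<rho> \<sigma>
            - hockey_stick \<gamma> (reduced_R dR dA \<rho>) (reduced_R dR dA \<sigma>)}"

end

theory Submission
  imports Defs "Jordan_Normal_Form.Spectral_Radius"
begin

text \<open>Take the binary symmetric channel with error probability \<open>1/(1+\<gamma>)\<close>. Two transition
  probabilities into the same output differ at most by the factor \<open>\<gamma>\<close>, so that
  \<open>\<N>(\<rho>) \<le> \<gamma> \<N>(\<sigma>)\<close> whenever \<open>\<rho>\<close> and \<open>\<sigma>\<close> have the same marginal on \<open>R\<close>; hence
  all numerators in \<open>\<eta>\<^sup>c\<close> vanish. Without the constraint on the marginals, the classical states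
  \<open>\<rho> = |00><00|\<close> and \<open>\<sigma> = (1/\<gamma>) |01><01| + (1-1/\<gamma>) |10><10|\<close> on \<open>RA\<close> satisfy
  \<open>E(\<rho>\<^sub>R, \<sigma>\<^sub>R) = 0\<close>, and their ratio in \<open>\<eta>\<^sup>\<Delta>\<close> is the total variation contraction
  \<open>(\<gamma>-1)/(\<gamma>+1) > 0\<close> of the channel.\<close>

section \<open>Adjoints\<close>

lemma dim_mat_diag [simp]: "dim_row (mat_diag n f) = n" "dim_col (mat_diag n f) = n"
  by (simp_all add: mat_diag_def)

lemma mat_adjoint_dim [simp]:
  "dim_row (mat_adjoint A) = dim_col A" "dim_col (mat_adjoint A) = dim_row A"
  unfolding mat_adjoint_def by auto

lemma mat_adjoint_carrier [simp, intro]: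
  "A \<in> carrier_mat m n \<Longrightarrow> mat_adjoint A \<in> carrier_mat n m"
  by auto

lemma mat_adjoint_index [simp]:
  fixes A :: "complex mat"
  assumes "i < dim_col A" "j < dim_row A"
  shows "mat_adjoint A $$ (i, j) = cnj (A $$ (j, i))"
  using assms unfolding mat_adjoint_def by (simp add: mat_of_rows_index)

lemma mat_adjoint_adjoint [simp]: "mat_adjoint (mat_adjoint A) = (A :: complex mat)"
  by (rule eq_matI) auto

lemma mat_adjoint_mult:
  fixes A :: "complex mat"
  assumes "A \<in> carrier_mat l m" "B \<in> carrier_mat m n"
  shows "mat_adjoint (A * B) = mat_adjoint B * mat_adjoint A"
proof (rule eq_matI)
  fix i j
  assume "i < dim_row (mat_adjoint B * mat_adjoint A)" "j < dim_col (mat_adjoint B * mat_adjoint A)"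
  then have "i < n" "j < l"
    using assms by auto
  then show "mat_adjoint (A * B) $$ (i, j) = (mat_adjoint B * mat_adjoint A) $$ (i, j)"
    using assms by (auto simp: scalar_prod_def intro!: sum.cong)
qed (use assms in auto)

lemma unitary_right_inverse:
  fixes U :: "complex mat"
  assumes "U \<in> carrier_mat n n" "mat_adjoint U * U = 1\<^sub>m n"
  shows "U * mat_adjoint U = 1\<^sub>m n"
  using mat_mult_left_right_inverse[OF _ assms(1) assms(2)] assms(1) by auto

text \<open>Passes between the form \<open>U D U*\<close> in which \<open>is_pos_part\<close> states
  a decomposition and the form \<open>U* A U = D\<close> that the inductive diagonalization
  produces.\<close>

lemma unitary_conj_eq_iff:
  fixes U :: "complex mat"
  assumes U: "U \<in> carrier_mat n n" "mat_adjoint U * U = 1\<^sub>m n"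
    and A: "A \<in> carrier_mat n n" and D: "D \<in> carrier_mat n n"
  shows "A = U * D * mat_adjoint U \<longleftrightarrow> mat_adjoint U * A * U = D"
proof -
  note UU = unitary_right_inverse[OF U]
  note [simp] = assoc_mult_mat[of _ n n _ n _ n] mult_carrier_mat[of _ n n _ n]
  have U': "mat_adjoint U \<in> carrier_mat n n"
    using U by auto
  have "mat_adjoint U * (U * D * mat_adjoint U) * U = (mat_adjoint U * U) * D * (mat_adjoint U * U)"
    using U(1) D U' by simp
  moreover have "U * (mat_adjoint U * A * U) * mat_adjoint U = (U * mat_adjoint U) * A * (U * mat_adjoint U)"
    using U(1) A U' by simp
  ultimately show ?thesis
    using U A D UU by auto
qed

section \<open>The spectral theorem\<close>

text \<open>Complete \<open>v\<close> to a basis, apply Gram-Schmidt, which keeps the first vector,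
  and normalize. The scalar \<open>c\<close> absorbs the normalization of \<open>v\<close>; for an
  eigenvector only the direction matters.\<close>

lemma unitary_with_first_column:
  fixes v :: "complex vec"
  assumes v: "v \<in> carrier_vec n" and v0: "v \<noteq> 0\<^sub>v n"
  shows "\<exists>W c. W \<in> carrier_mat n n \<and> mat_adjoint W * W = 1\<^sub>m n \<and> col W 0 = c \<cdot>\<^sub>v v"
proof -
  interpret cof_vec_space n "TYPE(complex)" .
  have n: "n \<noteq> 0"
    using v v0 by (metis eq_vecI carrier_vecD index_zero_vec(2) not_less_zero)
  define b where "b = basis_completion v"
  define ws where "ws = gram_schmidt n b"
  from basis_completion[OF v v0, folded b_def]
  have dist: "distinct b" and indep: "\<not> lin_dep (set b)" and b: "set b \<subseteq> carrier_vec n"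
    and hdb: "hd b = v" and len_b: "length b = n"
    by auto
  obtain vs where bv: "b = v # vs"
    using hdb len_b n by (cases b) auto
  from gram_schmidt_result[OF b dist indep refl, folded ws_def]
  have ws: "set ws \<subseteq> carrier_vec n" "corthogonal ws" "length ws = n"
    by (auto simp: len_b)
  have hdws: "hd ws = v"
    using gram_schmidt_hd[OF v, of vs] unfolding ws_def bv .
  then have ws0: "ws ! 0 = v"
    using ws(3) n by (metis hd_conv_nth length_0_conv)
  have ws_carrier: "ws ! i \<in> carrier_vec n" if "i < n" for i
    using ws that by auto
  \<comment> \<open>\<open>gram_schmidt\<close> yields orthogonal vectors that need not have unit
    length; \<open>N i\<close> is the squared norm by which the columns of \<open>W\<close> are
    rescaled.\<close>
  define N where "N i = (\<Sum>k<n. (cmod (ws ! i $ k))\<^sup>2)" for i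
  have prod: "ws ! j \<bullet>c ws ! i = (\<Sum>k<n. cnj (ws ! i $ k) * ws ! j $ k)" if "i < n" "j < n" for i j
    using ws_carrier[OF that(1)] ws_carrier[OF that(2)]
    by (auto simp: scalar_prod_def atLeast0LessThan mult.commute intro!: sum.cong)
  have norm: "(\<Sum>k<n. cnj (ws ! i $ k) * ws ! i $ k) = complex_of_real (N i)" for i
    unfolding N_def of_real_sum
    by (intro sum.cong refl) (simp add: complex_norm_square mult.commute del: of_real_power)
  have N_pos: "N i > 0" if "i < n" for i
  proof -
    \<comment> \<open>\<open>corthogonal\<close> makes an inner product vanish exactly for distinct
      indices, so no vector in the list has norm zero.\<close>
    have "complex_of_real (N i) \<noteq> 0"
      using corthogonalD[OF ws(2), of i i] that ws(3) prod[OF that that] norm[of i] by auto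
    moreover have "N i \<ge> 0"
      unfolding N_def by (intro sum_nonneg) auto
    ultimately show ?thesis
      by auto
  qed
  define W where "W = mat n n (\<lambda>(k, i). complex_of_real (1 / sqrt (N i)) * ws ! i $ k)"
  have W: "W \<in> carrier_mat n n"
    unfolding W_def by auto
  have "mat_adjoint W * W = 1\<^sub>m n"
  proof (rule eq_matI)
    fix i j assume "i < dim_row (1\<^sub>m n :: complex mat)" "j < dim_col (1\<^sub>m n :: complex mat)"
    then have ij: "i < n" "j < n"
      by auto
    have "(mat_adjoint W * W) $$ (i, j) =
        (\<Sum>k<n. complex_of_real (1 / sqrt (N i)) * complex_of_real (1 / sqrt (N j)) * (cnj (ws ! i $ k) * ws ! j $ k))"
      using ij W by (auto simp: scalar_prod_def atLeast0LessThan W_def intro!: sum.cong)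
    also have "\<dots> = complex_of_real (1 / sqrt (N i)) * complex_of_real (1 / sqrt (N j)) * (ws ! j \<bullet>c ws ! i)"
      unfolding prod[OF ij] sum_distrib_left ..
    also have "\<dots> = (if i = j then 1 else 0)"
    proof (cases "i = j")
      case True
      have "complex_of_real (1 / sqrt (N i)) * complex_of_real (1 / sqrt (N i)) * complex_of_real (N i)
          = complex_of_real (1 / sqrt (N i) * (1 / sqrt (N i)) * N i)"
        by (simp only: of_real_mult)
      also have "1 / sqrt (N i) * (1 / sqrt (N i)) * N i = 1"
        using N_pos[OF ij(1)] by simp
      finally show ?thesis
        using True prod[OF ij] norm[of i] by simp
    next
      case False
      then show ?thesis
        using corthogonalD[OF ws(2), of j i] ij ws(3) by auto
    qed
    finally show "(mat_adjoint W * W) $$ (i, j) = 1\<^sub>m n $$ (i, j)"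
      using ij by simp
  qed (use W in auto)
  moreover have "col W 0 = complex_of_real (1 / sqrt (N 0)) \<cdot>\<^sub>v v"
    using n v ws0 by (intro eq_vecI) (auto simp: W_def)
  ultimately show ?thesis
    using W by blast
qed

text \<open>Deflation: in an orthonormal basis starting with an eigenvector, the first column of the
  matrix is a multiple of the first basis vector. Hermiticity gives the same for the first row, so a
  smaller Hermitian block splits off and the induction hypothesis applies to it.\<close>

theorem hermitian_unitary_diagonalization:
  fixes A :: "complex mat"
  assumes "A \<in> carrier_mat n n" "mat_adjoint A = A"
  shows "\<exists>U d. U \<in> carrier_mat n n \<and> mat_adjoint U * U = 1\<^sub>m n \<and>
           mat_adjoint U * A * U = mat_diag n (\<lambda>i. complex_of_real (d i))"
  using assms
proof (induction n arbitrary: A)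
  case 0
  show ?case
    by (intro exI[of _ "1\<^sub>m 0"] exI[of _ "\<lambda>_. 0"] conjI) (auto intro!: eq_matI)
next
  case (Suc m)
  let ?n = "Suc m"
  note A = Suc.prems(1)
  note [simp] = assoc_mult_mat[of _ ?n ?n _ ?n _ ?n] mult_carrier_mat[of _ ?n ?n _ ?n]
  obtain e where "eigenvalue A e"
    using spectrum_non_empty[OF A] unfolding spectrum_def by auto
  then obtain v where v: "v \<in> carrier_vec ?n" "v \<noteq> 0\<^sub>v ?n" "A *\<^sub>v v = e \<cdot>\<^sub>v v"
    using A unfolding eigenvalue_def eigenvector_def by auto
  obtain W c where W: "W \<in> carrier_mat ?n ?n" "mat_adjoint W * W = 1\<^sub>m ?n" "col W 0 = c \<cdot>\<^sub>v v"
    using unitary_with_first_column[OF v(1,2)] by blast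
  have W': "mat_adjoint W \<in> carrier_mat ?n ?n"
    using W by auto
  define B where "B = mat_adjoint W * A * W"
  have B: "B \<in> carrier_mat ?n ?n"
    unfolding B_def using A W W' by simp
  have B_adj: "mat_adjoint B = B"
    unfolding B_def using A W W' Suc.prems(2)
    by (simp add: mat_adjoint_mult[of _ ?n ?n _ ?n])
  have AW0: "A *\<^sub>v col W 0 = e \<cdot>\<^sub>v col W 0"
    unfolding W(3) using A v by (simp add: mult_mat_vec smult_smult_assoc mult.commute)
  have B0: "B $$ (i, 0) = (if i = 0 then e else 0)" if i: "i < ?n" for i
  proof -
    have "B $$ (i, 0) = row (mat_adjoint W) i \<bullet> col (A * W) 0"
      unfolding B_def using A W W' i by simp
    also have "col (A * W) 0 = e \<cdot>\<^sub>v col W 0"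
      using A W AW0 by (subst col_mult2[of _ ?n ?n _ ?n]) auto
    also have "row (mat_adjoint W) i \<bullet> (e \<cdot>\<^sub>v col W 0) = e * (mat_adjoint W * W) $$ (i, 0)"
      using W(1) W' i by simp
    finally show ?thesis
      unfolding W(2) using i by simp
  qed
  have B_sym: "B $$ (i, j) = cnj (B $$ (j, i))" if "i < ?n" "j < ?n" for i j
    using that B B_adj by (metis mat_adjoint_index carrier_matD)
  \<comment> \<open>The corner entry equals its own conjugate, so the eigenvalue is real.\<close>
  have e: "e = complex_of_real (Re e)"
    using B_sym[of 0 0] B0[of 0] by (simp add: complex_eq_iff)
  have B0': "B $$ (0, j) = (if j = 0 then e else 0)" if "j < ?n" for j
    using B_sym[of 0 j] B0[of j] B0[of 0] B_sym[of 0 0] that by auto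
  define C where "C = mat m m (\<lambda>(i, j). B $$ (Suc i, Suc j))"
  have C: "C \<in> carrier_mat m m"
    unfolding C_def by auto
  have "mat_adjoint C = C"
    using C by (intro eq_matI) (auto simp: C_def B_sym[symmetric])
  from Suc.IH[OF C this] obtain V d where V: "V \<in> carrier_mat m m" "mat_adjoint V * V = 1\<^sub>m m"
      and d: "mat_adjoint V * C * V = mat_diag m (\<lambda>i. complex_of_real (d i))"
    by blast
  have V': "mat_adjoint V \<in> carrier_mat m m"
    using V by auto
  let ?z = "0\<^sub>m 1 m :: complex mat" and ?z' = "0\<^sub>m m 1 :: complex mat"
  \<comment> \<open>The unitary for the lower block is extended by 1 on the eigenvector;
    \<open>W * X\<close> then diagonalizes \<open>A\<close>.\<close>
  define X where "X = four_block_mat (1\<^sub>m 1) ?z ?z' V"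
  have X: "X \<in> carrier_mat ?n ?n"
    unfolding X_def using V by auto
  have X': "mat_adjoint X = four_block_mat (1\<^sub>m 1) ?z ?z' (mat_adjoint V)"
    using V by (intro eq_matI) (auto simp: X_def)
  have X'_carrier: "mat_adjoint X \<in> carrier_mat ?n ?n"
    using X by auto
  have B_block: "B = four_block_mat (mat 1 1 (\<lambda>_. e)) ?z ?z' C"
  proof (rule eq_matI)
    fix i j
    assume "i < dim_row (four_block_mat (mat 1 1 (\<lambda>_. e)) ?z ?z' C)"
      "j < dim_col (four_block_mat (mat 1 1 (\<lambda>_. e)) ?z ?z' C)"
    then have "i < ?n" "j < ?n"
      using C by auto
    then show "B $$ (i, j) = four_block_mat (mat 1 1 (\<lambda>_. e)) ?z ?z' C $$ (i, j)"
      using B0[of i] B0'[of j] C by (cases i; cases j) (auto simp: C_def)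
  qed (use B C in auto)
  have XX: "mat_adjoint X * X = 1\<^sub>m ?n"
    unfolding X' unfolding X_def
    by (subst mult_four_block_mat[of _ 1 1 _ m _ m _ _ 1 _ m]) (use V V' in \<open>auto intro!: eq_matI\<close>)
  have XBX: "mat_adjoint X * B * X = mat_diag ?n (\<lambda>i. complex_of_real (case i of 0 \<Rightarrow> Re e | Suc k \<Rightarrow> d k))"
  proof -
    have "mat_adjoint X * B = four_block_mat (mat 1 1 (\<lambda>_. e)) ?z ?z' (mat_adjoint V * C)"
      unfolding X' B_block
      by (subst mult_four_block_mat[of _ 1 1 _ m _ m _ _ 1 _ m]) (use V V' C in auto)
    then have "mat_adjoint X * B * X = four_block_mat (mat 1 1 (\<lambda>_. e)) ?z ?z' (mat_adjoint V * C * V)"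
      unfolding X_def
      by (simp, subst mult_four_block_mat[of _ 1 1 _ m _ m _ _ 1 _ m]) (use V V' C in auto)
    also have "\<dots> = mat_diag ?n (\<lambda>i. complex_of_real (case i of 0 \<Rightarrow> Re e | Suc k \<Rightarrow> d k))"
      unfolding d using e
      by (intro eq_matI) (auto simp: mat_diag_def split: nat.splits)
    finally show ?thesis .
  qed
  have adj: "mat_adjoint (W * X) = mat_adjoint X * mat_adjoint W"
    using W(1) X by (rule mat_adjoint_mult)
  have "mat_adjoint (W * X) * (W * X) = mat_adjoint X * ((mat_adjoint W * W) * X)"
    unfolding adj using W(1) W' X X'_carrier by simp
  then have "mat_adjoint (W * X) * (W * X) = 1\<^sub>m ?n"
    using W(2) XX X by simp
  moreover have "mat_adjoint (W * X) * A * (W * X) = mat_adjoint X * B * X"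
    unfolding adj B_def using A W(1) W' X X'_carrier by simp
  ultimately show ?case
    using W(1) X XBX by (intro exI[of _ "W * X"] exI conjI) simp_all
qed

section \<open>Positive parts\<close>

lemma unitary_matD:
  assumes "unitary_mat U" "dim_row U = n"
  shows "U \<in> carrier_mat n n" "mat_adjoint U * U = 1\<^sub>m n"
  using assms unfolding unitary_mat_def by auto

text \<open>If \<open>A = U D U* = V E V*\<close>, then \<open>V* U\<close> intertwines \<open>D\<close> and \<open>E\<close>, hence also their positive
  parts: its entry at \<open>(i, j)\<close> can only be nonzero when \<open>E\<close> at \<open>i\<close> equals \<open>D\<close> at \<open>j\<close>.\<close>

lemma is_pos_part_unique:
  assumes "is_pos_part A P" "is_pos_part A Q"
  shows "P = Q"
proof -
  define n where "n = dim_row A"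
  let ?D = "\<lambda>d. mat_diag n (\<lambda>i. complex_of_real (d i))"
  let ?p = "\<lambda>d i. max (d i) (0::real)"
  from assms(1) obtain U d where U: "unitary_mat U" "dim_row U = n"
      and d: "A = U * ?D d * mat_adjoint U" and P: "P = U * ?D (?p d) * mat_adjoint U"
    unfolding is_pos_part_def n_def by auto
  from assms(2) obtain V e where V: "unitary_mat V" "dim_row V = n"
      and e: "A = V * ?D e * mat_adjoint V" and Q: "Q = V * ?D (?p e) * mat_adjoint V"
    unfolding is_pos_part_def n_def by auto
  note U = unitary_matD[OF U] and V = unitary_matD[OF V]
  note UU = unitary_right_inverse[OF U] and VV = unitary_right_inverse[OF V]
  have adj: "mat_adjoint U \<in> carrier_mat n n" "mat_adjoint V \<in> carrier_mat n n"
    using U V by auto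
  have D: "?D f \<in> carrier_mat n n" for f
    by simp
  note [simp] = assoc_mult_mat[of _ n n _ n _ n] mult_carrier_mat[of _ n n _ n]
  define W where "W = mat_adjoint V * U"
  have W: "W \<in> carrier_mat n n"
    unfolding W_def using U adj by simp
  have "W * ?D d = mat_adjoint V * (U * ?D d * mat_adjoint U) * U"
    unfolding W_def using U adj D[of d] by simp
  also have "\<dots> = mat_adjoint V * (V * ?D e * mat_adjoint V) * U"
    using d e by simp
  also have "\<dots> = (mat_adjoint V * V) * (?D e * W)"
    unfolding W_def using U(1) V(1) adj D[of e] by simp
  finally have eq: "W * ?D d = ?D e * W"
    using V W D[of e] by simp
  have inter: "W $$ (i, j) * d j = e i * W $$ (i, j)" if "i < n" "j < n" for i j
    using arg_cong[OF eq[unfolded mat_diag_mult_right[OF W] mat_diag_mult_left[OF W]],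
        of "\<lambda>M. M $$ (i, j)"] that by simp
  have "W * ?D (?p d) = ?D (?p e) * W"
    unfolding mat_diag_mult_right[OF W] mat_diag_mult_left[OF W]
  proof (rule eq_matI)
    fix i j
    assume "i < dim_row (mat n n (\<lambda>(i, j). complex_of_real (?p e i) * W $$ (i, j)))"
      "j < dim_col (mat n n (\<lambda>(i, j). complex_of_real (?p e i) * W $$ (i, j)))"
    then have ij: "i < n" "j < n"
      by auto
    have "W $$ (i, j) = 0 \<or> d j = e i"
      using inter[OF ij] by (auto simp: mult.commute)
    then show "mat n n (\<lambda>(i, j). W $$ (i, j) * complex_of_real (?p d j)) $$ (i, j) =
        mat n n (\<lambda>(i, j). complex_of_real (?p e i) * W $$ (i, j)) $$ (i, j)"
      using ij by auto
  qed auto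
  \<comment> \<open>Undoing the conjugations turns the intertwining relation for the positive parts
    into \<open>P = Q\<close>.\<close>
  then have "V * (W * ?D (?p d)) * mat_adjoint U = V * (?D (?p e) * W) * mat_adjoint U"
    by simp
  moreover have "V * (W * ?D (?p d)) * mat_adjoint U = (V * mat_adjoint V) * P"
    unfolding W_def P using U(1) V(1) adj D[of "?p d"] by simp
  moreover have "V * (?D (?p e) * W) * mat_adjoint U = Q * (U * mat_adjoint U)"
    unfolding W_def Q using U(1) V(1) adj D[of "?p e"] by simp
  moreover have "P \<in> carrier_mat n n" "Q \<in> carrier_mat n n"
    unfolding P Q using U V adj D by (meson mult_carrier_mat)+
  ultimately show ?thesis
    using UU VV by simp
qed

text \<open>Uniqueness justifies the definite description: any one spectral decomposition computes
  the positive part.\<close>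

lemma pos_part_eqI: "is_pos_part A P \<Longrightarrow> pos_part A = P"
  unfolding pos_part_def using is_pos_part_unique by blast

lemma pos_part_diag:
  fixes d :: "nat \<Rightarrow> real"
  shows "pos_part (mat_diag n (\<lambda>i. complex_of_real (d i))) =
    mat_diag n (\<lambda>i. complex_of_real (max (d i) 0))"
proof (rule pos_part_eqI)
  have one: "mat_adjoint (1\<^sub>m n) = (1\<^sub>m n :: complex mat)"
    by (rule eq_matI) auto
  have "1\<^sub>m n * mat_diag n f * 1\<^sub>m n = mat_diag n f" for f :: "nat \<Rightarrow> complex"
    by (metis left_mult_one_mat mat_diag_dim right_mult_one_mat)
  then show "is_pos_part (mat_diag n (\<lambda>i. complex_of_real (d i)))
      (mat_diag n (\<lambda>i. complex_of_real (max (d i) 0)))"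
    unfolding is_pos_part_def
    by (intro exI[of _ "1\<^sub>m n"] exI[of _ d]) (auto simp: unitary_mat_def one)
qed

text \<open>Reduces statements about quadratic forms to rearrangements of finite sums over matrix
  entries.\<close>

lemma quadratic_form_sum:
  fixes M :: "complex mat"
  assumes "M \<in> carrier_mat n n" "v \<in> carrier_vec n"
  shows "(M *\<^sub>v v) \<bullet>c v = (\<Sum>i<n. \<Sum>j<n. cnj (v $ i) * M $$ (i, j) * v $ j)"
  using assms
  by (auto simp: scalar_prod_def atLeast0LessThan sum_distrib_left sum_distrib_right mult_ac
      intro!: sum.cong)

text \<open>Each eigenvalue is the value of the quadratic form at a column of the diagonalizing
  unitary, hence nonpositive, and its positive part is zero.\<close>

lemma pos_part_negative_semidefinite:
  fixes A :: "complex mat"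
  assumes A: "A \<in> carrier_mat n n" "mat_adjoint A = A"
    and neg: "\<And>v. v \<in> carrier_vec n \<Longrightarrow> Re ((A *\<^sub>v v) \<bullet>c v) \<le> 0"
  shows "pos_part A = 0\<^sub>m n n"
proof (rule pos_part_eqI)
  obtain U d where U: "U \<in> carrier_mat n n" "mat_adjoint U * U = 1\<^sub>m n"
      and d: "mat_adjoint U * A * U = mat_diag n (\<lambda>i. complex_of_real (d i))"
    using hermitian_unitary_diagonalization[OF A] by blast
  have "d i \<le> 0" if i: "i < n" for i
  proof -
    have "complex_of_real (d i) = (mat_adjoint U * (A * U)) $$ (i, i)"
      using d i A U assoc_mult_mat[of "mat_adjoint U" n n A n U n] by (simp add: mat_diag_def)
    also have "\<dots> = (A *\<^sub>v col U i) \<bullet>c col U i"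
      using A U i by (auto simp: scalar_prod_def mult.commute intro!: sum.cong)
    finally show ?thesis
      using neg[of "col U i"] U i by (metis Re_complex_of_real carrier_matD(1) col_carrier_vec carrier_matD(2))
  qed
  then have "mat_diag n (\<lambda>i. complex_of_real (max (d i) 0)) = 0\<^sub>m n n"
    by (intro eq_matI) (auto simp: mat_diag_def max_def antisym)
  moreover have "A = U * mat_diag n (\<lambda>i. complex_of_real (d i)) * mat_adjoint U"
    using unitary_conj_eq_iff[OF U A(1)] d by simp
  ultimately show "is_pos_part A (0\<^sub>m n n)"
    unfolding is_pos_part_def using A U
    by (intro exI[of _ U] exI[of _ d]) (auto simp: unitary_mat_def)
qed

section \<open>Hockey-stick divergences\<close>

text \<open>For commuting diagonal arguments the divergence is the classical one, evaluated entry by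
  entry.\<close>

lemma hockey_stick_diag:
  fixes f g :: "nat \<Rightarrow> real"
  shows "hockey_stick \<gamma> (mat_diag n (\<lambda>i. complex_of_real (f i))) (mat_diag n (\<lambda>i. complex_of_real (g i)))
    = (\<Sum>i<n. max (f i - \<gamma> * g i) 0)"
proof -
  have "mat_diag n (\<lambda>i. complex_of_real (f i)) - complex_of_real \<gamma> \<cdot>\<^sub>m mat_diag n (\<lambda>i. complex_of_real (g i))
      = mat_diag n (\<lambda>i. complex_of_real (f i - \<gamma> * g i))"
    by (intro eq_matI) (auto simp: mat_diag_def)
  then have "hockey_stick \<gamma> (mat_diag n (\<lambda>i. complex_of_real (f i))) (mat_diag n (\<lambda>i. complex_of_real (g i)))
      = Re (mat_trace (mat_diag n (\<lambda>i. complex_of_real (max (f i - \<gamma> * g i) 0))))"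
    unfolding hockey_stick_def pos_part_diag[symmetric] by (rule arg_cong)
  then show ?thesis
    by (simp add: mat_trace_def mat_diag_def)
qed

text \<open>The assumption \<open>le\<close> is the operator inequality \<rho> \<le> \<gamma>
  \<sigma>, tested on vectors; it makes the difference negative semidefinite.\<close>

lemma hockey_stick_eq_0:
  assumes \<rho>: "\<rho> \<in> carrier_mat n n" "mat_adjoint \<rho> = \<rho>"
    and \<sigma>: "\<sigma> \<in> carrier_mat n n" "mat_adjoint \<sigma> = \<sigma>"
    and le: "\<And>v. v \<in> carrier_vec n \<Longrightarrow> Re ((\<rho> *\<^sub>v v) \<bullet>c v) \<le> \<gamma> * Re ((\<sigma> *\<^sub>v v) \<bullet>c v)"
  shows "hockey_stick \<gamma> \<rho> \<sigma> = 0"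
proof -
  let ?A = "\<rho> - complex_of_real \<gamma> \<cdot>\<^sub>m \<sigma>"
  have A: "?A \<in> carrier_mat n n"
    using \<rho> \<sigma> by auto
  have sym: "cnj (M $$ (j, i)) = M $$ (i, j)"
    if "mat_adjoint M = M" "M \<in> carrier_mat n n" "i < n" "j < n" for M i j
    using that by (metis mat_adjoint_index carrier_matD)
  have adj: "mat_adjoint ?A = ?A"
    using \<rho> \<sigma> by (intro eq_matI) (auto simp: sym)
  have "Re ((?A *\<^sub>v v) \<bullet>c v) \<le> 0" if v: "v \<in> carrier_vec n" for v
  proof -
    have "(?A *\<^sub>v v) \<bullet>c v = (\<rho> *\<^sub>v v) \<bullet>c v - complex_of_real \<gamma> * ((\<sigma> *\<^sub>v v) \<bullet>c v)"
      unfolding quadratic_form_sum[OF A v] quadratic_form_sum[OF \<rho>(1) v] quadratic_form_sum[OF \<sigma>(1) v]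
        sum_distrib_left sum_subtractf[symmetric]
      using \<rho>(1) \<sigma>(1) by (intro sum.cong refl) (auto simp: algebra_simps)
    then show ?thesis
      using le[OF v] by simp
  qed
  from pos_part_negative_semidefinite[OF A adj this] show ?thesis
    unfolding hockey_stick_def by (simp add: mat_trace_def)
qed

section \<open>Classical channels\<close>

lemma dim_id_tensor [simp]:
  "dim_row (id_tensor dR dA dB N M) = dR * dB" "dim_col (id_tensor dR dA dB N M) = dR * dB"
  by (simp_all add: id_tensor_def)

text \<open>Splits a sum over a composite index into its two factors, following the layout
  \<open>r * n + y\<close>.\<close>

lemma sum_mult_split:
  fixes f :: "nat \<Rightarrow> 'a :: comm_monoid_add"
  shows "(\<Sum>i<m * n. f i) = (\<Sum>r<m. \<Sum>y<n. f (r * n + y))"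
proof -
  have "(\<Sum>i\<in>{r * n..<r * n + n}. f i) = (\<Sum>y<n. f (r * n + y))" for r
    using sum.shift_bounds_nat_ivl[of f 0 "r * n" n] by (simp add: atLeast0LessThan add.commute)
  then show ?thesis
    using sum.nat_group[of f n m] by simp
qed

lemma index_less_mult: "r * n + y < m * (n :: nat)" if "r < m" "y < n"
proof -
  have "r * n + y < Suc r * n"
    using that by simp
  also have "\<dots> \<le> m * n"
    using that by (intro mult_le_mono1) simp
  finally show ?thesis .
qed

lemma id_tensor_carrier [simp]: "id_tensor dR dA dB N M \<in> carrier_mat (dR * dB) (dR * dB)"
  unfolding id_tensor_def by simp

text \<open>The channel reads only the diagonal of each block and writes only to the diagonal, so
  off-diagonal entries survive in the reference but not in the output system.\<close>

lemma id_tensor_classical_index: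
  assumes "r < dR" "y < dB" "s < dR" "y' < dB"
  shows "id_tensor dR dA dB (classical_channel dA dB W) M $$ (r * dB + y, s * dB + y') =
    (if y = y' then \<Sum>x<dA. complex_of_real (W y x) * M $$ (r * dA + x, s * dA + x) else 0)"
  using assms
  by (auto simp: id_tensor_def index_less_mult classical_channel_def mat_diag_def subblock_def)

lemma id_tensor_classical_adjoint:
  assumes M: "M \<in> carrier_mat (dR * dA) (dR * dA)" "mat_adjoint M = M"
  shows "mat_adjoint (id_tensor dR dA dB (classical_channel dA dB W) M) =
    id_tensor dR dA dB (classical_channel dA dB W) M" (is "mat_adjoint ?N = ?N")
proof (rule eq_matI)
  have N: "?N \<in> carrier_mat (dR * dB) (dR * dB)"
    by simp
  show "dim_row (mat_adjoint ?N) = dim_row ?N" "dim_col (mat_adjoint ?N) = dim_col ?N"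
    using N by auto
  fix i j assume "i < dim_row ?N" "j < dim_col ?N"
  then have ij: "i < dR * dB" "j < dR * dB"
    using N by auto
  then have dB: "dB > 0"
    by (cases dB) auto
  define r y s y' where "r = i div dB" "y = i mod dB" "s = j div dB" "y' = j mod dB"
  have i: "i = r * dB + y" and j: "j = s * dB + y'"
    unfolding r_y_s_y'_def by simp_all
  have b: "r < dR" "y < dB" "s < dR" "y' < dB"
    unfolding r_y_s_y'_def using ij dB by (auto simp: less_mult_imp_div_less)
  have sym: "cnj (M $$ (s * dA + x, r * dA + x)) = M $$ (r * dA + x, s * dA + x)" if "x < dA" for x
    using M b that by (metis mat_adjoint_index carrier_matD index_less_mult)
  have "mat_adjoint ?N $$ (i, j) = cnj (?N $$ (j, i))"
    using ij N by simp
  also have "\<dots> = ?N $$ (i, j)"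
    unfolding i j id_tensor_classical_index[OF b] id_tensor_classical_index[OF b(3,4,1,2)]
    using sym by (auto intro!: sum.cong)
  finally show "mat_adjoint ?N $$ (i, j) = ?N $$ (i, j)" .
qed

text \<open>\<open>slice\<close> is \<open>(I \<otimes> <y|) v\<close> for a vector \<open>v\<close> of \<open>RB\<close>, and \<open>tensor_ket\<close> is \<open>u \<otimes> |x>\<close>.\<close>

definition slice :: "nat \<Rightarrow> nat \<Rightarrow> complex vec \<Rightarrow> nat \<Rightarrow> complex vec" where
  "slice dR dB v y = vec dR (\<lambda>r. v $ (r * dB + y))"

definition tensor_ket :: "nat \<Rightarrow> nat \<Rightarrow> complex vec \<Rightarrow> nat \<Rightarrow> complex vec" where
  "tensor_ket dR dA u x = vec (dR * dA) (\<lambda>k. if k mod dA = x then u $ (k div dA) else 0)"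

text \<open>The vector is supported on the indices whose \<open>A\<close>-component is
  \<open>x\<close>, which collapses both sums over \<open>A\<close>.\<close>

lemma quadratic_form_tensor_ket:
  assumes M: "M \<in> carrier_mat (dR * dA) (dR * dA)" and x: "x < dA"
  shows "(M *\<^sub>v tensor_ket dR dA u x) \<bullet>c tensor_ket dR dA u x =
    (\<Sum>r<dR. \<Sum>s<dR. cnj (u $ r) * M $$ (r * dA + x, s * dA + x) * u $ s)"
proof -
  have t: "tensor_ket dR dA u x \<in> carrier_vec (dR * dA)"
    unfolding tensor_ket_def by simp
  have idx: "tensor_ket dR dA u x $ (r * dA + a) = (if a = x then u $ r else 0)" if "r < dR" "a < dA" for r a
    using that unfolding tensor_ket_def by (simp add: index_less_mult)
  have "(M *\<^sub>v tensor_ket dR dA u x) \<bullet>c tensor_ket dR dA u x =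
    (\<Sum>r<dR. \<Sum>a<dA. \<Sum>s<dR. \<Sum>b<dA. cnj (if a = x then u $ r else 0) *
       M $$ (r * dA + a, s * dA + b) * (if b = x then u $ s else 0))"
    unfolding quadratic_form_sum[OF M t] sum_mult_split
    by (intro sum.cong refl) (simp add: idx)
  also have "\<dots> = (\<Sum>r<dR. \<Sum>a<dA. if a = x then \<Sum>s<dR. cnj (u $ r) * M $$ (r * dA + x, s * dA + x) * u $ s else 0)"
    using x by (intro sum.cong refl) (auto simp: if_distrib sum.delta cong: if_cong)
  finally show ?thesis
    using x by (simp add: sum.delta)
qed

text \<open>Heisenberg picture: the adjoint of the channel sends the projector on \<open>v\<close>
  to the sum of the projectors on \<open>t y x\<close> with weights \<open>W y x\<close>. This turns
  an operator inequality for outputs into one between weighted sums of input forms.\<close>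

lemma quadratic_form_id_tensor_classical:
  assumes M: "M \<in> carrier_mat (dR * dA) (dR * dA)" and v: "v \<in> carrier_vec (dR * dB)"
  defines "t \<equiv> \<lambda>y x. tensor_ket dR dA (slice dR dB v y) x"
  shows "(id_tensor dR dA dB (classical_channel dA dB W) M *\<^sub>v v) \<bullet>c v =
    (\<Sum>y<dB. \<Sum>x<dA. complex_of_real (W y x) * ((M *\<^sub>v t y x) \<bullet>c t y x))"
proof -
  let ?N = "id_tensor dR dA dB (classical_channel dA dB W) M"
  let ?m = "\<lambda>y x r s. complex_of_real (W y x) *
    (cnj (v $ (r * dB + y)) * M $$ (r * dA + x, s * dA + x) * v $ (s * dB + y))"
  have "(?N *\<^sub>v v) \<bullet>c v = (\<Sum>r<dR. \<Sum>y<dB. \<Sum>s<dR. \<Sum>y'<dB.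
     cnj (v $ (r * dB + y)) * ?N $$ (r * dB + y, s * dB + y') * v $ (s * dB + y'))"
    unfolding quadratic_form_sum[OF id_tensor_carrier v] sum_mult_split ..
  also have "\<dots> = (\<Sum>r<dR. \<Sum>y<dB. \<Sum>s<dR. \<Sum>y'<dB. if y' = y then \<Sum>x<dA. ?m y x r s else 0)"
    by (intro sum.cong refl)
      (auto simp: id_tensor_classical_index sum_distrib_left sum_distrib_right mult_ac)
  also have "\<dots> = (\<Sum>r<dR. \<Sum>y<dB. \<Sum>s<dR. \<Sum>x<dA. ?m y x r s)"
    by (simp cong: sum.cong_simp)
  also have "\<dots> = (\<Sum>y<dB. \<Sum>x<dA. \<Sum>r<dR. \<Sum>s<dR. ?m y x r s)"
    \<comment> \<open>Both instances only move a sum over \<open>R\<close> inside a sum over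
      \<open>A\<close> or \<open>B\<close>, so the rewriting terminates.\<close>
    by (simp only: sum.swap[where A = "{..<dR}" and B = "{..<dA}"] sum.swap[where A = "{..<dR}" and B = "{..<dB}"])
  also have "\<dots> = (\<Sum>y<dB. \<Sum>x<dA. complex_of_real (W y x) * ((M *\<^sub>v t y x) \<bullet>c t y x))"
    unfolding t_def
    by (intro sum.cong refl)
      (auto simp: quadratic_form_tensor_ket[OF M] slice_def sum_distrib_left intro!: sum.cong)
  finally show ?thesis .
qed

text \<open>This is the partial trace over \<open>A\<close>. Through it, equality of the marginals
  on \<open>R\<close> enters the bound on the outputs.\<close>

lemma sum_quadratic_form_tensor_ket:
  assumes M: "M \<in> carrier_mat (dR * dA) (dR * dA)" and u: "u \<in> carrier_vec dR"
  shows "(\<Sum>x<dA. (M *\<^sub>v tensor_ket dR dA u x) \<bullet>c tensor_ket dR dA u x) =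
    (reduced_R dR dA M *\<^sub>v u) \<bullet>c u"
proof -
  have R: "reduced_R dR dA M \<in> carrier_mat dR dR"
    unfolding reduced_R_def by simp
  have "(\<Sum>x<dA. (M *\<^sub>v tensor_ket dR dA u x) \<bullet>c tensor_ket dR dA u x) =
      (\<Sum>x<dA. \<Sum>r<dR. \<Sum>s<dR. cnj (u $ r) * M $$ (r * dA + x, s * dA + x) * u $ s)"
    by (intro sum.cong refl) (simp add: quadratic_form_tensor_ket[OF M])
  also have "\<dots> = (\<Sum>r<dR. \<Sum>s<dR. \<Sum>x<dA. cnj (u $ r) * M $$ (r * dA + x, s * dA + x) * u $ s)"
    by (subst sum.swap) (intro sum.cong refl sum.swap)
  also have "\<dots> = (reduced_R dR dA M *\<^sub>v u) \<bullet>c u"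
    unfolding quadratic_form_sum[OF R u]
    by (intro sum.cong refl)
      (simp add: reduced_R_def mat_trace_def subblock_def sum_distrib_left sum_distrib_right)
  finally show ?thesis .
qed

text \<open>The number \<open>c y\<close> separates the largest \<open>W y x\<close> from \<gamma>
  times the smallest. For fixed \<open>y\<close> the input forms are nonnegative and have the same
  sum over \<open>x\<close> for both states, so the \<rho>-side is at most \<open>c y\<close> times
  this common sum, which is at most \<gamma> times the \<sigma>-side.\<close>

lemma hockey_stick_classical_channel_eq_0:
  assumes \<rho>: "density_mat (dR * dA) \<rho>" and \<sigma>: "density_mat (dR * dA) \<sigma>"
    and marg: "reduced_R dR dA \<rho> = reduced_R dR dA \<sigma>"
    and W: "\<And>y x. y < dB \<Longrightarrow> x < dA \<Longrightarrow> W y x \<le> c y \<and> c y \<le> \<gamma> * W y x"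
  shows "hockey_stick \<gamma> (id_tensor dR dA dB (classical_channel dA dB W) \<rho>)
    (id_tensor dR dA dB (classical_channel dA dB W) \<sigma>) = 0"
proof -
  have \<rho>M: "\<rho> \<in> carrier_mat (dR * dA) (dR * dA)" "mat_adjoint \<rho> = \<rho>"
    and \<sigma>M: "\<sigma> \<in> carrier_mat (dR * dA) (dR * dA)" "mat_adjoint \<sigma> = \<sigma>"
    using \<rho> \<sigma> unfolding density_mat_def psd_mat_def hermitian_mat_def by auto
  have t: "tensor_ket dR dA u x \<in> carrier_vec (dR * dA)" for u x
    unfolding tensor_ket_def by simp
  define q where "q M v y x = Re ((M *\<^sub>v tensor_ket dR dA (slice dR dB v y) x) \<bullet>c
    tensor_ket dR dA (slice dR dB v y) x)" for M v y x
  have psd: "q M v y x \<ge> 0" if "density_mat (dR * dA) M" for M v y x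
    using that t unfolding q_def density_mat_def psd_mat_def less_eq_complex_def by auto
  show ?thesis
  proof (rule hockey_stick_eq_0)
    fix v :: "complex vec"
    assume v: "v \<in> carrier_vec (dR * dB)"
    have out: "Re ((id_tensor dR dA dB (classical_channel dA dB W) M *\<^sub>v v) \<bullet>c v) =
        (\<Sum>y<dB. \<Sum>x<dA. W y x * q M v y x)" if "M \<in> carrier_mat (dR * dA) (dR * dA)" for M
      unfolding quadratic_form_id_tensor_classical[OF that v] q_def by simp
    have "(\<Sum>x<dA. W y x * q \<rho> v y x) \<le> \<gamma> * (\<Sum>x<dA. W y x * q \<sigma> v y x)" if y: "y < dB" for y
    proof -
      \<comment> \<open>Both sums are the quadratic form of the common marginal at the slice of
        \<open>v\<close>.\<close>
      have "(\<Sum>x<dA. q \<rho> v y x) = (\<Sum>x<dA. q \<sigma> v y x)"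
        unfolding q_def Re_sum[symmetric]
        using sum_quadratic_form_tensor_ket[of _ dR dA "slice dR dB v y"] \<rho>M \<sigma>M marg
        by (simp add: slice_def)
      moreover have "(\<Sum>x<dA. W y x * q \<rho> v y x) \<le> (\<Sum>x<dA. c y * q \<rho> v y x)"
        using W y psd[OF \<rho>] by (intro sum_mono mult_right_mono) auto
      moreover have "(\<Sum>x<dA. c y * q \<sigma> v y x) \<le> (\<Sum>x<dA. \<gamma> * W y x * q \<sigma> v y x)"
        using W y psd[OF \<sigma>] by (intro sum_mono mult_right_mono) auto
      ultimately show ?thesis
        by (simp add: sum_distrib_left[symmetric] mult.assoc)
    qed
    then show "Re ((id_tensor dR dA dB (classical_channel dA dB W) \<rho> *\<^sub>v v) \<bullet>c v) \<le>
        \<gamma> * Re ((id_tensor dR dA dB (classical_channel dA dB W) \<sigma> *\<^sub>v v) \<bullet>c v)"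
      unfolding out[OF \<rho>M(1)] out[OF \<sigma>M(1)] sum_distrib_left[of \<gamma> _ "{..<dB}"]
      by (intro sum_mono) auto
  qed (use \<rho>M \<sigma>M in \<open>simp_all add: id_tensor_classical_adjoint\<close>)
qed

lemma eta_c_eq_0:
  assumes "\<And>y x. y < dB \<Longrightarrow> x < dA \<Longrightarrow> W y x \<le> c y \<and> c y \<le> \<gamma> * W y x"
  shows "eta_c \<gamma> dA dB (classical_channel dA dB W) = 0"
proof -
  have sup: "sup_or_zero S = 0" if "\<And>a. a \<in> S \<Longrightarrow> a = 0" for S
  proof -
    \<comment> \<open>The empty set is covered by the default value 0 of
      \<open>sup_or_zero\<close>.\<close>
    have "S = {} \<or> S = {0}"
      using that by blast
    then show ?thesis
      unfolding sup_or_zero_def by auto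
  qed
  have ratio: "hockey_stick \<gamma> (id_tensor dR dA dB (classical_channel dA dB W) \<rho>)
      (id_tensor dR dA dB (classical_channel dA dB W) \<sigma>) / hockey_stick \<gamma> \<rho> \<sigma> = 0"
    if "density_mat (dR * dA) \<rho>" "density_mat (dR * dA) \<sigma>" "reduced_R dR dA \<rho> = reduced_R dR dA \<sigma>"
    for dR \<rho> \<sigma>
    using hockey_stick_classical_channel_eq_0[OF that assms] by simp
  show ?thesis
    unfolding eta_c_def by (rule sup) (elim CollectE exE conjE, simp only: ratio)
qed

section \<open>Diagonal states\<close>

text \<open>On diagonal states the extended channel is a classical stochastic map acting on the
  second component of the index.\<close>

lemma id_tensor_classical_diag:
  "id_tensor dR dA dB (classical_channel dA dB W) (mat_diag (dR * dA) (\<lambda>i. complex_of_real (f i))) =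
    mat_diag (dR * dB) (\<lambda>i. complex_of_real (\<Sum>x<dA. W (i mod dB) x * f (i div dB * dA + x)))"
proof (rule eq_matI)
  let ?N = "id_tensor dR dA dB (classical_channel dA dB W) (mat_diag (dR * dA) (\<lambda>i. complex_of_real (f i)))"
  let ?D = "mat_diag (dR * dB) (\<lambda>i. complex_of_real (\<Sum>x<dA. W (i mod dB) x * f (i div dB * dA + x)))"
  fix i j assume "i < dim_row ?D" "j < dim_col ?D"
  then have ij: "i < dR * dB" "j < dR * dB"
    by (auto simp: mat_diag_def)
  then have dB: "dB > 0"
    by (cases dB) auto
  have b: "i div dB < dR" "i mod dB < dB" "j div dB < dR" "j mod dB < dB"
    using ij dB by (auto simp: less_mult_imp_div_less)
  \<comment> \<open>For \<open>y = y'\<close> the remaining off-diagonal entries join different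
    blocks; these vanish because the input is diagonal.\<close>
  have eq: "i mod dB = j mod dB \<Longrightarrow> i div dB = j div dB \<longleftrightarrow> i = j"
    by (metis div_mult_mod_eq)
  have "?N $$ (i, j) = ?N $$ (i div dB * dB + i mod dB, j div dB * dB + j mod dB)"
    by simp
  also have "\<dots> = ?D $$ (i, j)"
    unfolding id_tensor_classical_index[OF b]
    using ij b eq by (cases "i = j") (auto simp: mat_diag_def index_less_mult)
  finally show "?N $$ (i, j) = ?D $$ (i, j)" .
qed (auto simp: id_tensor_def mat_diag_def)

lemma reduced_R_diag:
  "reduced_R dR dA (mat_diag (dR * dA) (\<lambda>i. complex_of_real (f i))) =
    mat_diag dR (\<lambda>r. complex_of_real (\<Sum>a<dA. f (r * dA + a)))"
  by (intro eq_matI)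
    (auto simp: reduced_R_def mat_trace_def subblock_def mat_diag_def index_less_mult)

lemma density_mat_diag:
  assumes "\<And>i. i < n \<Longrightarrow> f i \<ge> 0" "(\<Sum>i<n. f i) = 1"
  shows "density_mat n (mat_diag n (\<lambda>i. complex_of_real (f i)))"
proof -
  let ?D = "mat_diag n (\<lambda>i. complex_of_real (f i))"
  have "(?D *\<^sub>v v) \<bullet>c v = complex_of_real (\<Sum>i<n. f i * (cmod (v $ i))\<^sup>2)" if "v \<in> carrier_vec n" for v
  proof -
    have "(?D *\<^sub>v v) \<bullet>c v = (\<Sum>i<n. \<Sum>j<n. if j = i then complex_of_real (f i) * (v $ i * cnj (v $ i)) else 0)"
      unfolding quadratic_form_sum[OF mat_diag_dim that]
      by (intro sum.cong refl) (auto simp: mat_diag_def)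
    also have "\<dots> = complex_of_real (\<Sum>i<n. f i * (cmod (v $ i))\<^sup>2)"
      by (simp add: sum.delta complex_norm_square del: of_real_power)
    finally show ?thesis .
  qed
  moreover have "(\<Sum>i<n. f i * (cmod (v $ i))\<^sup>2) \<ge> 0" for v
    using assms(1) by (intro sum_nonneg) auto
  moreover have "mat_adjoint ?D = ?D"
    by (intro eq_matI) (auto simp: mat_diag_def)
  moreover have "mat_trace ?D = complex_of_real (\<Sum>i<n. f i)"
    by (simp add: mat_trace_def mat_diag_def)
  ultimately show ?thesis
    unfolding density_mat_def psd_mat_def hermitian_mat_def
    using assms(2) by (auto simp: less_eq_complex_def)
qed

section \<open>The binary symmetric channel and a separating pair of classical states\<close>

theorem mainTheorem13:
  fixes \<gamma> :: real
  assumes "\<gamma> > 1"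
  shows "\<exists>nX nY (W :: nat \<Rightarrow> nat \<Rightarrow> real).
           0 < nX \<and> 0 < nY \<and> cond_distribution nX nY W \<and>
           eta_Delta \<gamma> nX nY (classical_channel nX nY W) >
           eta_c \<gamma> nX nY (classical_channel nX nY W)"
proof -
  define W :: "nat \<Rightarrow> nat \<Rightarrow> real" where "W y x = (if y = x then \<gamma> else 1) / (1 + \<gamma>)" for y x
  let ?N = "classical_channel 2 2 W"
  have two: "{..<2} = {0, 1::nat}" and four: "{..<4} = {0, 1, 2, 3::nat}"
    by auto
  have cond: "cond_distribution 2 2 W"
    using assms unfolding cond_distribution_def W_def two by (auto simp: less_2_cases_iff add_divide_distrib[symmetric] add.commute)
  \<comment> \<open>The constant is the larger transition probability, which is exactly \<gamma>
    times the smaller one.\<close>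
  have c: "eta_c \<gamma> 2 2 ?N = 0"
    by (rule eta_c_eq_0[where c = "\<lambda>_. \<gamma> / (1 + \<gamma>)"]) (use assms in \<open>auto simp: W_def divide_right_mono\<close>)
  \<comment> \<open>Index \<open>r * 2 + a\<close> encodes the pair \<open>(r, a)\<close>: 0 is
    \<open>00\<close>, 1 is \<open>01\<close>, 2 is \<open>10\<close>. The weight
    \<open>1 / \<gamma>\<close> is chosen so that \<gamma> times the marginal of \<sigma> equals 1
    at \<open>r = 0\<close>, matching the marginal of \<rho>.\<close>
  define f g :: "nat \<Rightarrow> real"
    where "f = (\<lambda>i. if i = 0 then 1 else 0)"
      and "g = (\<lambda>i. if i = 1 then 1 / \<gamma> else if i = 2 then 1 - 1 / \<gamma> else 0)"
  let ?\<rho> = "mat_diag (2 * 2) (\<lambda>i. complex_of_real (f i))"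
  let ?\<sigma> = "mat_diag (2 * 2) (\<lambda>i. complex_of_real (g i))"
  have \<rho>: "density_mat (2 * 2) ?\<rho>"
    by (rule density_mat_diag) (auto simp: f_def four)
  have \<sigma>: "density_mat (2 * 2) ?\<sigma>"
    by (rule density_mat_diag) (use assms in \<open>auto simp: g_def four\<close>)
  have reduced: "hockey_stick \<gamma> (reduced_R 2 2 ?\<rho>) (reduced_R 2 2 ?\<sigma>) = 0"
    unfolding reduced_R_diag hockey_stick_diag using assms
    by (auto simp: two f_def g_def field_simps)
  \<comment> \<open>The supports are disjoint, so nothing is subtracted from the full weight of
    \<rho>.\<close>
  have inp: "hockey_stick \<gamma> ?\<rho> ?\<sigma> = 1"
    unfolding hockey_stick_diag using assms
    by (auto simp: four f_def g_def field_simps)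
  \<comment> \<open>The diagonal of the output operator whose positive part is traced. In the block
    \<open>r = 0\<close> the factor \<gamma> cancels the weight \<open>1 / \<gamma>\<close>, leaving
    differences of transition probabilities; only the entry at 0 is positive.\<close>
  define \<Delta> where "\<Delta> i = (\<Sum>x<2. W (i mod 2) x * f (i div 2 * 2 + x))
      - \<gamma> * (\<Sum>x<2. W (i mod 2) x * g (i div 2 * 2 + x))" for i
  have W_nonneg: "W y x \<ge> 0" for y x
    using assms unfolding W_def by simp
  have "\<Delta> 0 = W 0 0 - W 0 1" "\<Delta> 1 = W 1 0 - W 1 1"
    "\<Delta> 2 = - (\<gamma> * W 0 0 * (1 - 1 / \<gamma>))" "\<Delta> 3 = - (\<gamma> * W 1 0 * (1 - 1 / \<gamma>))"
    using assms unfolding \<Delta>_def f_def g_def two by simp_all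
  moreover have "W 0 0 - W 0 1 = (\<gamma> - 1) / (\<gamma> + 1)" "W 1 0 - W 1 1 \<le> 0"
    using assms unfolding W_def by (simp_all add: diff_divide_distrib add.commute divide_right_mono)
  moreover have "\<gamma> * W y x * (1 - 1 / \<gamma>) \<ge> 0" for y x
    using assms W_nonneg by (intro mult_nonneg_nonneg) auto
  moreover have "(\<gamma> - 1) / (\<gamma> + 1) \<ge> 0"
    using assms by simp
  ultimately have "(\<Sum>i<4. max (\<Delta> i) 0) = (\<gamma> - 1) / (\<gamma> + 1)"
    unfolding four by (simp add: max_def)
  then have outp: "hockey_stick \<gamma> (id_tensor 2 2 2 ?N ?\<rho>) (id_tensor 2 2 2 ?N ?\<sigma>) = (\<gamma> - 1) / (\<gamma> + 1)"
    unfolding id_tensor_classical_diag hockey_stick_diag \<Delta>_def by simp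
  have "ereal ((\<gamma> - 1) / (\<gamma> + 1)) \<le> eta_Delta \<gamma> 2 2 ?N"
  proof -
    have mem: "a \<in> S \<Longrightarrow> ereal a \<le> sup_or_zero S" for a S
      unfolding sup_or_zero_def by (auto intro: SUP_upper)
    show ?thesis
      unfolding eta_Delta_def
      by (rule mem, rule CollectI, rule exI[of _ 2], rule exI[of _ ?\<rho>], rule exI[of _ ?\<sigma>])
        (use \<rho> \<sigma> reduced inp outp in simp)
  qed
  \<comment> \<open>Strict separation comes from \<gamma> > 1.\<close>
  moreover have "ereal ((\<gamma> - 1) / (\<gamma> + 1)) > 0"
    using assms by simp
  ultimately have "eta_Delta \<gamma> 2 2 ?N > eta_c \<gamma> 2 2 ?N"
    unfolding c by (rule less_le_trans[rotated])
  then show ?thesis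
    using cond by (intro exI[of _ 2] exI[of _ W]) auto
qed

end
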